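(* Let $n\ge1$. The functional $\mu$ is not necessarily additive on separated sets in $\mathcal{E}$: there exist a bounded open set $\Omega\subset\mathbb{R}^n$ with $C^{1,\gamma}$-boundary (for some $\gamma\in(0,1)$) and sets $E,F\in\mathcal{E}$ with $E\cup F\in\mathcal{E}$ such that $\mathrm{dist}(E,F)\ge c$ for some $c>0$, but $$\mu(E\cup F)<\mu(E)+\mu(F).$$ Also, $\mu$ is not necessarily monotone on $\mathcal{E}$: there exist a bounded open set $\Omega\subset\mathbb{R}^n$ with $C^{1,\gamma}$-boundary and sets $E,F\in\mathcal{E}$ such that $E\subseteq F$ but $\mu(E)>\mu(F)$.
   Context: For $s\in(0,1)$ and measurable $A,B\subseteq\mathbb{R}^n$, set $L(A,B):=\int_A\int_B\frac{1}{|x-y|^{n+s}}\,dx\,dy\in[0,+\infty]$ (with $L(A,B)=0$ if $A$ or $B$ is empty). Write $\mathcal{C}E=\mathbb{R}^n\setminus E$. The $s$-perimeter of a measurable set $E\subseteq\mathbb{R}^n$ in a bounded open set $\Omega$ is $$\mathrm{Per}_s(E;\Omega):=L(E\cap\Omega,(\mathcal{C}E)\cap\Omega)+L(E\cap\Omega,(\mathcal{C}E)\cap(\mathcal{C}\Omega))+L(E\cap(\mathcal{C}\Omega),(\mathcal{C}E)\cap\Omega).$$ Given $\Omega$, $\mathcal{E}$ denotes the family of measurable sets $E\subseteq\mathbb{R}^n$ for which the limit $\mu(E):=\lim_{s\searrow0}s\,\mathrm{Per}_s(E;\Omega)$ exists (as a finite number); both $\mathcal{E}$ and $\mu$ depend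 on $\Omega$. $\mathrm{dist}(E,F)=\inf\{|x-y|:x\in E,\,y\in F\}$. *)

theory Defs
  imports "HOL-Analysis.Analysis"
begin

text \<open>The division is taken in \<^typ>\<open>ennreal\<close>, so the kernel is infinite on the diagonal.\<close>

definition interaction :: "real \<Rightarrow> 'a::euclidean_space set \<Rightarrow> 'a set \<Rightarrow> ennreal" where
  "interaction s A B =
     (\<integral>\<^sup>+x\<in>A. (\<integral>\<^sup>+y\<in>B. 1 / ennreal (norm (x - y) powr (real DIM('a) + s)) \<partial>lebesgue) \<partial>lebesgue)"

definition s_perimeter :: "real \<Rightarrow> 'a::euclidean_space set \<Rightarrow> 'a set \<Rightarrow> ennreal" where
  "s_perimeter s E \<Omega> =
     interaction s (E \<inter> \<Omega>) ((- E) \<inter> \<Omega>) +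
     interaction s (E \<inter> \<Omega>) ((- E) \<inter> (- \<Omega>)) +
     interaction s (E \<inter> (- \<Omega>)) ((- E) \<inter> \<Omega>)"

text \<open>The limit is required to be a finite number, hence of the form \<^term>\<open>ennreal m\<close>.\<close>

definition mu_family :: "'a::euclidean_space set \<Rightarrow> 'a set set" where
  "mu_family \<Omega> = {E \<in> sets lebesgue.
     \<exists>m::real. ((\<lambda>s. ennreal s * s_perimeter s E \<Omega>) \<longlongrightarrow> ennreal m) (at_right 0)}"

text \<open>Only meaningful on \<^const>\<open>mu_family\<close>.\<close>

definition mu :: "'a::euclidean_space set \<Rightarrow> 'a set \<Rightarrow> real" where
  "mu \<Omega> E = enn2real (Lim (at_right 0) (\<lambda>s. ennreal s * s_perimeter s E \<Omega>))"

definition C1_holder_on :: "real \<Rightarrow> 'a::euclidean_space set \<Rightarrow> ('a \<Rightarrow> real) \<Rightarrow> bool" where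
  "C1_holder_on \<gamma> U \<phi> \<longleftrightarrow>
     (\<exists>g::'a \<Rightarrow> 'a. \<exists>C::real.
        (\<forall>x\<in>U. (\<phi> has_derivative (\<lambda>h. g x \<bullet> h)) (at x)) \<and>
        (\<forall>x\<in>U. \<forall>y\<in>U. norm (g x - g y) \<le> C * norm (x - y) powr \<gamma>))"

text \<open>
  Near each boundary point \<open>\<Omega>\<close> is the strict epigraph, in some direction \<open>e\<close>, of a
  \<open>C\<^sup>1\<close> function with \<open>\<gamma>\<close>-Hoelder gradient.  A function of the \<open>n - 1\<close> variables
  orthogonal to \<open>e\<close> is represented by a function on the whole space that is constant
  along \<open>e\<close>; for \<open>n = 1\<close> it is therefore a constant.
\<close>

definition C1_holder_boundary :: "real \<Rightarrow> 'a::euclidean_space set \<Rightarrow> bool" where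
  "C1_holder_boundary \<gamma> \<Omega> \<longleftrightarrow>
     (\<forall>p\<in>frontier \<Omega>. \<exists>r>0. \<exists>e::'a. \<exists>\<phi>::'a \<Rightarrow> real.
        norm e = 1 \<and>
        (\<forall>x t. \<phi> (x + t *\<^sub>R e) = \<phi> x) \<and>
        C1_holder_on \<gamma> (ball p r) \<phi> \<and>
        \<Omega> \<inter> ball p r = {x \<in> ball p r. \<phi> x < x \<bullet> e})"

end

theory Submission
  imports Defs
begin

text \<open>
  Let \<open>\<Omega>\<close> be the unit ball, \<open>E\<close> the ball of radius 2 and \<open>F\<close> the complement of the ball of radius 3.
  In the limit \<open>s \<rightarrow> 0\<close> only the interaction with points near infinity survives the factor \<open>s\<close>.
  For \<open>E\<close> and for \<open>F\<close> the set \<open>\<Omega>\<close> interacts with a neighbourhood of infinity, which gives the same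
  positive limit for both. For \<open>E \<union> F\<close> it interacts only with a bounded annulus at positive
  distance, which gives the limit 0. The pair \<open>E \<subseteq> E \<union> F\<close> also refutes monotonicity.
\<close>

section \<open>Regularity of the unit sphere\<close>

text \<open>The gradient of the graph function is even Lipschitz as long as the graph stays away
  from vertical. On a bounded set Lipschitz implies Hoelder, so 1/2 is just one choice of exponent
  in (0,1).\<close>

lemma C1_holder_boundary_unit_ball: "C1_holder_boundary (1/2) (ball (0::'a::euclidean_space) 1)"
  unfolding C1_holder_boundary_def
proof
  \<comment> \<open>Near \<open>p\<close> the ball is the epigraph of \<open>\<phi>\<close> in the inward direction \<open>- p\<close>.\<close>
  fix p :: 'a
  assume "p \<in> frontier (ball 0 1)"
  then have p: "norm p = 1" by (simp add: frontier_ball)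
  then have pp: "p \<bullet> p = 1" by (simp add: dot_square_norm)
  \<comment> \<open>\<open>q\<close> is the orthogonal projection onto the hyperplane perpendicular
    to \<open>p\<close>; since \<phi> depends on \<open>q x\<close> alone, it is constant along
    \<open>p\<close>. \<open>g\<close> will be its gradient.\<close>
  define q where "q x = x - (x \<bullet> p) *\<^sub>R p" for x
  define \<phi> where "\<phi> x = - sqrt (1 - q x \<bullet> q x)" for x
  define g where "g x = q x /\<^sub>R sqrt (1 - q x \<bullet> q x)" for x
  have qp: "q x \<bullet> p = 0" for x by (simp add: q_def inner_diff_left pp)
  have qq: "q x \<bullet> q x = x \<bullet> x - (x \<bullet> p)\<^sup>2" for x
    by (simp add: q_def inner_diff_left inner_diff_right pp inner_commute power2_eq_square)
  have qdiff: "q (x - y) = q x - q y" for x y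
    by (simp add: q_def algebra_simps)
  have qnorm: "norm (q x) \<le> norm x" for x
    using qq[of x] by (simp add: norm_le)
  have "q p = 0" by (simp add: q_def pp)
  have qball: "norm (q x) < 1/2" if "x \<in> ball p (1/2)" for x
    using qnorm[of "x - p"] that by (simp add: qdiff \<open>q p = 0\<close> dist_norm norm_minus_commute)
  \<comment> \<open>The left side is at least 3/4 because \<open>q x\<close> has norm below 1/2;
    16/25 is a rational square below 3/4, which gives the clean bound 4/5 for the root.\<close>
  have qsq: "1 - q x \<bullet> q x > (4/5)\<^sup>2" if "x \<in> ball p (1/2)" for x
  proof -
    have "(norm (q x))\<^sup>2 \<le> (1/2)\<^sup>2"
      using qball[OF that] by (intro power_mono) auto
    then have "q x \<bullet> q x \<le> (1/2)\<^sup>2" by (simp only: power2_norm_eq_inner)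
    then show ?thesis by (simp add: power2_eq_square)
  qed
  have qsqrt: "sqrt (1 - q x \<bullet> q x) > 4/5" if "x \<in> ball p (1/2)" for x
    by (rule real_less_rsqrt[OF qsq[OF that]])
  have deriv: "(\<phi> has_derivative (\<lambda>h. g x \<bullet> h)) (at x)" if "x \<in> ball p (1/2)" for x
  proof -
    have pos: "1 - q x \<bullet> q x > 0" using qsq[OF that] by (rule le_less_trans[rotated]) simp
    have "(q has_derivative q) (at x)"
      unfolding q_def by (auto intro!: derivative_eq_intros)
    then have "(\<phi> has_derivative (\<lambda>h. (q x \<bullet> q h) / sqrt (1 - q x \<bullet> q x))) (at x)"
      unfolding \<phi>_def using pos
      by (auto intro!: derivative_eq_intros simp: inner_commute field_simps)
    moreover have "q x \<bullet> q h = q x \<bullet> h" for h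
      by (simp add: q_def[of h] inner_diff_right qp)
    ultimately show ?thesis by (simp add: g_def divide_inverse mult.commute)
  qed
  have lip: "norm (g x - g y) \<le> 4 * norm (x - y) powr (1/2)"
    if x: "x \<in> ball p (1/2)" and y: "y \<in> ball p (1/2)" for x y
  proof -
    define a b where "a = sqrt (1 - q x \<bullet> q x)" and "b = sqrt (1 - q y \<bullet> q y)"
    have ab: "a > 4/5" "b > 4/5" using qsqrt x y by (auto simp: a_def b_def)
    have d: "norm (q x - q y) \<le> norm (x - y)" using qnorm[of "x - y"] by (simp add: qdiff)
    have sq: "a\<^sup>2 = 1 - q x \<bullet> q x" "b\<^sup>2 = 1 - q y \<bullet> q y"
      using qsq[OF x] qsq[OF y] unfolding a_def b_def
      by (auto intro!: real_sqrt_pow2 simp: power2_eq_square)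
    have "\<bar>b\<^sup>2 - a\<^sup>2\<bar> = \<bar>(q x - q y) \<bullet> (q x + q y)\<bar>"
      by (simp add: sq inner_diff_left inner_add_right inner_commute[of "q y" "q x"])
    also have "\<dots> \<le> norm (q x - q y) * norm (q x + q y)" by (rule Cauchy_Schwarz_ineq2)
    also have "\<dots> \<le> norm (x - y) * 1"
      using qball[OF x] qball[OF y] norm_triangle_ineq[of "q x" "q y"]
      by (intro mult_mono d) auto
    finally have "\<bar>b - a\<bar> * (a + b) \<le> norm (x - y)"
      using ab by (simp add: power2_eq_square square_diff_square_factored abs_mult add.commute mult.commute)
    moreover have "\<bar>b - a\<bar> \<le> \<bar>b - a\<bar> * (a + b)"
      using ab mult_left_mono[of 1 "a + b" "\<bar>b - a\<bar>"] by simp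
    ultimately have ba: "\<bar>b - a\<bar> \<le> norm (x - y)" by (rule order_trans[rotated])
    have inv: "inverse a \<le> 5/4" "inverse b \<le> 5/4"
      using ab le_imp_inverse_le[of "4/5" a] le_imp_inverse_le[of "4/5" b] by auto
    \<comment> \<open>Product-rule splitting: one term for the change of \<open>q\<close>, one for
      the change of the root. The estimates add up to 5/4 + 25/16, which is below 4.\<close>
    have "g x - g y = (q x - q y) /\<^sub>R a + (inverse a - inverse b) *\<^sub>R q y"
      by (simp add: g_def a_def b_def algebra_simps)
    also have "norm \<dots> \<le> norm (q x - q y) * inverse a + \<bar>inverse a - inverse b\<bar> * norm (q y)"
      using ab by (intro norm_triangle_le) (simp add: mult.commute)
    also have "\<bar>inverse a - inverse b\<bar> = \<bar>b - a\<bar> * (inverse a * inverse b)"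
      using ab by (simp add: inverse_diff_inverse abs_mult abs_minus_commute)
    also have "norm (q x - q y) * inverse a + \<bar>b - a\<bar> * (inverse a * inverse b) * norm (q y)
        \<le> norm (x - y) * (5/4) + norm (x - y) * (5/4 * (5/4)) * 1"
      using ab inv d ba qball[OF y] by (intro add_mono mult_mono) auto
    also have "\<dots> \<le> 4 * norm (x - y)" by simp
    \<comment> \<open>Two points of a ball of radius 1/2 are less than 1 apart, and on [0,1] a
      number is at most its square root.\<close>
    also have "norm (x - y) \<le> norm (x - y) powr (1/2)"
    proof -
      have "dist x y < 1" using dist_triangle_half_r[of p x 1 y] x y by (simp add: dist_commute)
      then have "norm (x - y) powr 1 \<le> norm (x - y) powr (1/2)"
        by (intro powr_mono') (auto simp: dist_norm)
      then show ?thesis by simp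
    qed
    finally show ?thesis by simp
  qed
  have graph: "ball 0 1 \<inter> ball p (1/2) = {x \<in> ball p (1/2). \<phi> x < x \<bullet> (- p)}"
  proof -
    have "norm x < 1 \<longleftrightarrow> \<phi> x < x \<bullet> (- p)" if x: "x \<in> ball p (1/2)" for x
    proof -
      have "\<bar>(p - x) \<bullet> p\<bar> \<le> norm (p - x) * norm p" by (rule Cauchy_Schwarz_ineq2)
      also have "\<dots> < 1/2" using x p by (simp add: dist_norm)
      finally have pos: "x \<bullet> p > 0" unfolding inner_diff_left pp by linarith
      \<comment> \<open>Positivity of \<open>x \<bullet> p\<close> selects the right hemisphere and
        allows squaring; then Pythagoras (\<open>qq\<close>) turns the inequality into |x| <
        1.\<close>
      have "\<phi> x < x \<bullet> (- p) \<longleftrightarrow> sqrt ((x \<bullet> p)\<^sup>2) < sqrt (1 - q x \<bullet> q x)"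
        using pos by (simp add: \<phi>_def)
      also have "\<dots> \<longleftrightarrow> x \<bullet> x < 1" by (subst real_sqrt_less_iff) (auto simp: qq)
      finally show ?thesis by (simp add: norm_lt_square flip: power2_norm_eq_inner)
    qed
    then show ?thesis by auto
  qed
  have const: "\<phi> (x + t *\<^sub>R (- p)) = \<phi> x" for x t
  proof -
    have "q (x + t *\<^sub>R (- p)) = q x" by (simp add: q_def inner_diff_left pp algebra_simps)
    then show ?thesis by (simp add: \<phi>_def)
  qed
  show "\<exists>r>0. \<exists>e \<phi>. norm e = 1 \<and> (\<forall>x t. \<phi> (x + t *\<^sub>R e) = \<phi> x) \<and>
      C1_holder_on (1/2) (ball p r) \<phi> \<and> ball 0 1 \<inter> ball p r = {x \<in> ball p r. \<phi> x < x \<bullet> e}"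
  proof (rule exI[of _ "1/2"], intro conjI exI[of _ "- p"] exI[of _ \<phi>])
    show "C1_holder_on (1/2) (ball p (1/2)) \<phi>"
      unfolding C1_holder_on_def using deriv lip by blast
  qed (use p const graph in simp_all)
qed

section \<open>The kernel: powers, measurability, symmetry\<close>

lemma one_divide_ennreal_powr:
  "1 / ennreal (r powr a) = ennreal (r powr (- a))" if "r > 0"
  using that divide_ennreal[of 1 "r powr a"] by (simp add: powr_minus_divide)

lemma kernel_measurable [measurable]:
  "(\<lambda>(x, y). 1 / ennreal (norm (x - y :: 'a::euclidean_space) powr a)) \<in> borel_measurable (borel \<Otimes>\<^sub>M borel)"
  by measurable

text \<open>The kernel is symmetric, so Tonelli exchanges the two sets. Borel sets permit the
  passage from \<open>lebesgue\<close> to \<open>lborel\<close>, where Tonelli is applied. This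
  serves the set \<open>F\<close> below, for which the unit ball stands in the second place.\<close>

lemma interaction_commute:
  assumes [measurable]: "A \<in> sets borel" "B \<in> sets borel"
  shows "interaction s A B = interaction s B A"
proof -
  let ?k = "\<lambda>x y. 1 / ennreal (norm (x - y) powr (real DIM('a) + s))"
  have "interaction s A B = (\<integral>\<^sup>+x. \<integral>\<^sup>+y. ?k x y * indicator B y * indicator A x \<partial>lborel \<partial>lborel)"
    by (simp add: interaction_def nn_integral_completion nn_integral_multc)
  also have "\<dots> = (\<integral>\<^sup>+y. \<integral>\<^sup>+x. ?k x y * indicator B y * indicator A x \<partial>lborel \<partial>lborel)"
    by (rule lborel_pair.Fubini'[symmetric]) measurable
  also have "\<dots> = (\<integral>\<^sup>+y. \<integral>\<^sup>+x. ?k y x * indicator A x * indicator B y \<partial>lborel \<partial>lborel)"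
    by (simp add: norm_minus_commute mult_ac)
  also have "\<dots> = interaction s B A"
    by (simp add: interaction_def nn_integral_completion nn_integral_multc)
  finally show ?thesis .
qed

section \<open>Exact integral of the kernel outside a ball\<close>

lemma nn_integral_powr_atLeast:
  fixes a R :: real
  assumes "a > 1" "R > 0"
  shows "(\<integral>\<^sup>+t\<in>{R..}. ennreal (t powr (- a)) \<partial>lborel) = ennreal (R powr (1 - a) / (a - 1))"
proof -
  have "(\<integral>\<^sup>+t\<in>{R..}. ennreal (t powr (- a)) \<partial>lborel) = ennreal (0 - (- (R powr (1 - a) / (a - 1))))"
  proof (rule nn_integral_FTC_atLeast)
    show "DERIV (\<lambda>t. - (t powr (1 - a) / (a - 1))) t :> t powr (- a)" if "R \<le> t" for t
    proof -
      have "DERIV (\<lambda>t. - (t powr (1 - a) / (a - 1))) t :> - ((1 - a) * t powr (1 - a - 1) / (a - 1))"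
        using that assms by (auto intro!: derivative_eq_intros)
      also have "(1 - a) * t powr (1 - a - 1) = - (t powr (- a) * (a - 1))"
        by (simp add: algebra_simps)
      finally show ?thesis using assms by simp
    qed
    have "((\<lambda>t. t powr (1 - a)) \<longlongrightarrow> 0) at_top"
      using assms by (intro tendsto_neg_powr filterlim_ident) auto
    then show "((\<lambda>t. - (t powr (1 - a) / (a - 1))) \<longlongrightarrow> 0) at_top"
      using tendsto_minus[OF tendsto_divide[OF _ tendsto_const[of "a - 1"]]] assms by fastforce
  qed auto
  then show ?thesis by simp
qed

text \<open>Layer cake: \<open>r powr (- a)\<close> is the integral of \<open>a * t powr (- a - 1)\<close> over \<open>t \<ge> r\<close>, so
  exchanging the integrals leaves only volumes of balls.\<close>
lemma nn_integral_kernel_outside_ball: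
  fixes x :: "'a::euclidean_space"
  assumes s: "s > 0" and R: "R > 0"
  shows "(\<integral>\<^sup>+y\<in>- ball x R. 1 / ennreal (norm (x - y) powr (real DIM('a) + s)) \<partial>lebesgue) =
    ennreal (real DIM('a) * unit_ball_vol DIM('a) * R powr (- s) / s)"
proof -
  define n V where "n = real DIM('a)" and "V = unit_ball_vol DIM('a)"
  have n: "n > 0" and V: "V > 0" by (auto simp: n_def V_def)
  define w where "w t = ennreal ((n + s) * t powr (- (n + s + 1)))" for t
  have [measurable]: "w \<in> borel_measurable borel" unfolding w_def by measurable
  \<comment> \<open>For \<open>y\<close> outside \<open>ball x R\<close> the indicators cut the
    integral down to \<open>t \<ge> norm (x - y)\<close>; for \<open>y\<close> inside, both sides
    vanish.\<close>
  have cake: "1 / ennreal (norm (x - y) powr (n + s)) * indicator (- ball x R) y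
      = (\<integral>\<^sup>+t. w t * indicator {R..} t * indicator (cball x t - ball x R) y \<partial>lborel)" for y
  proof (cases "y \<in> ball x R")
    case False
    define r where "r = norm (x - y)"
    have r: "r \<ge> R" using False by (simp add: r_def dist_norm)
    have "(\<integral>\<^sup>+t. w t * indicator {R..} t * indicator (cball x t - ball x R) y \<partial>lborel)
        = (\<integral>\<^sup>+t. ennreal (n + s) * (ennreal (t powr (- (n + s + 1))) * indicator {r..} t) \<partial>lborel)"
      using False r R n s
      by (intro nn_integral_cong) (auto simp: w_def r_def dist_norm indicator_def ennreal_mult')
    also have "\<dots> = ennreal (n + s) * ennreal (r powr (1 - (n + s + 1)) / (n + s + 1 - 1))"
      using r R n s nn_integral_powr_atLeast[of "n + s + 1" r] by (subst nn_integral_cmult) simp_all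
    also have "\<dots> = ennreal (r powr (- (n + s)))"
      using n s by (subst ennreal_mult'[symmetric]) auto
    also have "\<dots> = 1 / ennreal (r powr (n + s))"
      using r R by (simp add: one_divide_ennreal_powr)
    finally show ?thesis using False by (simp add: r_def)
  qed simp
  have shell: "emeasure lborel (cball x t - ball x R) = ennreal (V * (t powr n - R powr n))" if "t \<ge> R" for t
  proof -
    have "emeasure lborel (cball x t - ball x R) = ennreal (V * t ^ DIM('a)) - ennreal (V * R ^ DIM('a))"
      using that R ball_subset_cball[of x R] subset_cball[of R t x]
      by (subst emeasure_Diff) (auto simp: emeasure_cball emeasure_ball V_def)
    then show ?thesis
      using that R V by (simp add: ennreal_minus n_def powr_realpow right_diff_distrib)
  qed
  have "(\<integral>\<^sup>+y\<in>- ball x R. 1 / ennreal (norm (x - y) powr (real DIM('a) + s)) \<partial>lebesgue)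
      = (\<integral>\<^sup>+y. (\<integral>\<^sup>+t. w t * indicator {R..} t * indicator (cball x t - ball x R) y \<partial>lborel) \<partial>lborel)"
    by (simp add: nn_integral_completion cake flip: n_def)
  also have "\<dots> = (\<integral>\<^sup>+t. (\<integral>\<^sup>+y. w t * indicator {R..} t * indicator (cball x t - ball x R) y \<partial>lborel) \<partial>lborel)"
  proof (rule lborel_pair.Fubini')
    \<comment> \<open>The shell moves with \<open>t\<close>, so joint measurability is shown with
      membership written as a condition on \<open>dist x y\<close>.\<close>
    have "(\<lambda>(t, y). w t * indicator {R..} t * (if dist x y \<le> t \<and> \<not> dist x y < R then 1 else 0 :: ennreal))
        \<in> borel_measurable (lborel \<Otimes>\<^sub>M lborel)" by measurable
    also have "(\<lambda>(t, y). w t * indicator {R..} t * (if dist x y \<le> t \<and> \<not> dist x y < R then 1 else 0 :: ennreal))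
        = (\<lambda>(t, y). w t * indicator {R..} t * indicator (cball x t - ball x R) y)"
      by (auto simp: fun_eq_iff)
    finally show "(\<lambda>(t, y). w t * indicator {R..} t * indicator (cball x t - ball x R) y)
        \<in> borel_measurable (lborel \<Otimes>\<^sub>M lborel)" .
  qed
  also have "\<dots> = (\<integral>\<^sup>+t. w t * indicator {R..} t * emeasure lborel (cball x t - ball x R) \<partial>lborel)"
    by (simp add: nn_integral_cmult_indicator)
  also have "\<dots> = (\<integral>\<^sup>+t. ennreal ((n + s) * V * (t powr (- (s + 1)) - R powr n * t powr (- (n + s + 1)))) * indicator {R..} t \<partial>lborel)"
  proof (intro nn_integral_cong)
    fix t :: real
    show "w t * indicator {R..} t * emeasure lborel (cball x t - ball x R)
      = ennreal ((n + s) * V * (t powr (- (s + 1)) - R powr n * t powr (- (n + s + 1)))) * indicator {R..} t"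
    proof (cases "t \<ge> R")
      case True
      have "t powr (- (n + s + 1)) * t powr n = t powr (- (s + 1))"
        by (simp flip: powr_add)
      then have eq: "(n + s) * t powr (- (n + s + 1)) * (V * (t powr n - R powr n))
         = (n + s) * V * (t powr (- (s + 1)) - R powr n * t powr (- (n + s + 1)))"
        by (simp add: algebra_simps)
      have "w t * emeasure lborel (cball x t - ball x R)
         = ennreal ((n + s) * t powr (- (n + s + 1)) * (V * (t powr n - R powr n)))"
        unfolding w_def shell[OF True] using n s by (subst ennreal_mult') auto
      from this[unfolded eq] show ?thesis using True by simp
    qed simp
  qed
  \<comment> \<open>An antiderivative whose powers of \<open>t\<close> have negative exponents, so
    it vanishes at infinity and only its value at \<open>R\<close> remains.\<close>
  also let ?F = "\<lambda>t. (n + s) * V * (R powr n * (t powr (- (n + s)) / (n + s)) - t powr (- s) / s)"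
  have "\<dots> = ennreal (0 - (n + s) * V * (R powr n * (R powr (- (n + s)) / (n + s)) - R powr (- s) / s))"
  proof (rule nn_integral_FTC_atLeast[where F = ?F])
    fix t assume t: "R \<le> t"
    show "DERIV ?F t :>
       (n + s) * V * (t powr (- (s + 1)) - R powr n * t powr (- (n + s + 1)))"
      using t R s n by (auto intro!: derivative_eq_intros) (auto simp: field_simps)
    have "t powr (- (s + 1)) = t powr n * t powr (- (n + s + 1))"
      by (simp flip: powr_add)
    moreover have "R powr n \<le> t powr n" using t R n by (intro powr_mono2) auto
    ultimately show "0 \<le> (n + s) * V * (t powr (- (s + 1)) - R powr n * t powr (- (n + s + 1)))"
      using n s V by (auto intro!: mult_nonneg_nonneg mult_right_mono)
  next
    have "((\<lambda>t. t powr (- b)) \<longlongrightarrow> 0) at_top" if "b > 0" for b :: real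
      using that by (intro tendsto_neg_powr filterlim_ident) auto
    from this[of "n + s"] this[of s]
    have "(?F \<longlongrightarrow>
       (n + s) * V * (R powr n * (0 / (n + s)) - 0 / s)) at_top"
      using n s by (intro tendsto_intros) auto
    then show "(?F \<longlongrightarrow> 0) at_top"
      by simp
  qed measurable
  also have "R powr n * (R powr (- (n + s)) / (n + s)) = R powr (- s) / (n + s)"
    by (simp flip: powr_add)
  \<comment> \<open>Since 1/s - 1/(n+s) = n/(s(n+s)), the factor \<open>n + s\<close>
    cancels.\<close>
  also have "0 - (n + s) * V * (R powr (- s) / (n + s) - R powr (- s) / s) = n * V * R powr (- s) / s"
    using n s add_pos_pos[OF n s] by (simp add: divide_simps) (simp add: algebra_simps)
  finally show ?thesis by (simp add: n_def V_def)
qed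

section \<open>Limits of the interactions as s tends to 0\<close>

text \<open>For |x| < 1, \<open>ball 0 R\<close> lies between the balls around \<open>x\<close> of
  radii \<open>R - 1\<close> and \<open>R + 1\<close>, and outside these the kernel integral is
  known exactly and does not depend on \<open>x\<close>.\<close>

lemma interaction_ball_complement_bounds:
  fixes s R :: real
  assumes s: "s > 0" and R: "R > 1"
  defines "c \<equiv> real DIM('a::euclidean_space) * (unit_ball_vol DIM('a))\<^sup>2"
  shows "ennreal s * interaction s (ball (0::'a) 1) (- ball 0 R) \<le> ennreal (c * (R - 1) powr (- s))"
    and "ennreal (c * (R + 1) powr (- s)) \<le> ennreal s * interaction s (ball (0::'a) 1) (- ball 0 R)"
proof -
  let ?k = "\<lambda>x y::'a. 1 / ennreal (norm (x - y) powr (real DIM('a) + s))"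
  let ?V = "unit_ball_vol DIM('a)"
  have V0: "?V \<ge> 0" by simp
  \<comment> \<open>One factor \<open>?V\<close> comes from the kernel integral, the other is the
    volume of the unit ball; the prefactor \<open>s\<close> cancels the 1/s.\<close>
  have const: "ennreal s * (\<integral>\<^sup>+x\<in>ball (0::'a) 1. ennreal (real DIM('a) * ?V * \<rho> powr (- s) / s) \<partial>lebesgue)
      = ennreal (c * \<rho> powr (- s))" for \<rho>
  proof -
    have "ennreal s * (\<integral>\<^sup>+x\<in>ball (0::'a) 1. ennreal (real DIM('a) * ?V * \<rho> powr (- s) / s) \<partial>lebesgue)
       = ennreal s * (ennreal (real DIM('a) * ?V * \<rho> powr (- s) / s) * ennreal ?V)"
      by (subst nn_integral_cmult_indicator) (auto simp: emeasure_ball)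
    also have "\<dots> = ennreal (s * (real DIM('a) * ?V * \<rho> powr (- s) / s * ?V))"
      by (simp only: ennreal_mult'[OF less_imp_le[OF s]] ennreal_mult''[OF V0])
    also have "s * (real DIM('a) * ?V * \<rho> powr (- s) / s * ?V) = c * \<rho> powr (- s)"
      using s by (simp add: c_def power2_eq_square)
    finally show ?thesis .
  qed
  have nn_mono: "(\<integral>\<^sup>+y\<in>A. ?k x y \<partial>lebesgue) \<le> (\<integral>\<^sup>+y\<in>B. ?k x y \<partial>lebesgue)" if "A \<subseteq> B" for A B x
    using that by (intro nn_integral_mono) (auto split: split_indicator)
  have "interaction s (ball (0::'a) 1) (- ball 0 R)
     \<le> (\<integral>\<^sup>+x\<in>ball (0::'a) 1. ennreal (real DIM('a) * ?V * (R - 1) powr (- s) / s) \<partial>lebesgue)"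
    unfolding interaction_def
  proof (intro nn_integral_mono)
    fix x :: 'a
    have "- ball 0 R \<subseteq> - ball x (R - 1)" if "norm x < 1"
    proof -
      have "norm y < R" if "dist x y < R - 1" for y
        using that \<open>norm x < 1\<close> norm_triangle_sub[of y x] by (simp add: dist_norm norm_minus_commute)
      then show ?thesis by auto
    qed
    then show "(\<integral>\<^sup>+y\<in>- ball 0 R. ?k x y \<partial>lebesgue) * indicator (ball 0 1) x
       \<le> ennreal (real DIM('a) * ?V * (R - 1) powr (- s) / s) * indicator (ball 0 1) x"
      using nn_mono[of "- ball 0 R" "- ball x (R - 1)" x] nn_integral_kernel_outside_ball[of s "R - 1" x] s R
      by (auto split: split_indicator)
  qed
  from mult_left_mono[OF this zero_le, of "ennreal s"]
  show "ennreal s * interaction s (ball (0::'a) 1) (- ball 0 R) \<le> ennreal (c * (R - 1) powr (- s))"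
    by (simp only: const)
  have "(\<integral>\<^sup>+x\<in>ball (0::'a) 1. ennreal (real DIM('a) * ?V * (R + 1) powr (- s) / s) \<partial>lebesgue)
    \<le> interaction s (ball (0::'a) 1) (- ball 0 R)"
    unfolding interaction_def
  proof (intro nn_integral_mono)
    fix x :: 'a
    have "- ball x (R + 1) \<subseteq> - ball 0 R" if "norm x < 1"
    proof -
      have "dist x y < R + 1" if "norm y < R" for y
        using that \<open>norm x < 1\<close> norm_triangle_ineq4[of x y] by (simp add: dist_norm)
      then show ?thesis by auto
    qed
    then show "ennreal (real DIM('a) * ?V * (R + 1) powr (- s) / s) * indicator (ball 0 1) x
       \<le> (\<integral>\<^sup>+y\<in>- ball 0 R. ?k x y \<partial>lebesgue) * indicator (ball 0 1) x"
      using nn_mono[of "- ball x (R + 1)" "- ball 0 R" x] nn_integral_kernel_outside_ball[of s "R + 1" x] s R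
      by (auto split: split_indicator)
  qed
  from mult_left_mono[OF this zero_le, of "ennreal s"]
  show "ennreal (c * (R + 1) powr (- s)) \<le> ennreal s * interaction s (ball (0::'a) 1) (- ball 0 R)"
    by (simp only: const)
qed

text \<open>Both bounds depend on the radius only through \<rho>^(-s), which tends to 1. Hence the
  limit does not see \<open>R\<close>.\<close>

lemma tendsto_interaction_ball_complement:
  assumes "R > 1"
  shows "((\<lambda>s. ennreal s * interaction s (ball (0::'a::euclidean_space) 1) (- ball 0 R)) \<longlongrightarrow>
    ennreal (real DIM('a) * (unit_ball_vol DIM('a))\<^sup>2)) (at_right 0)"
proof (rule tendsto_sandwich)
  let ?c = "real DIM('a) * (unit_ball_vol DIM('a))\<^sup>2"
  have lim: "((\<lambda>s. ennreal (?c * \<rho> powr (- s))) \<longlongrightarrow> ennreal ?c) (at_right 0)" if "\<rho> > 0" for \<rho> :: real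
  proof (rule tendsto_ennrealI)
    have "((\<lambda>s. ?c * \<rho> powr (- s)) \<longlongrightarrow> ?c * \<rho> powr (- 0)) (at_right 0)"
      using that by (intro tendsto_intros) auto
    then show "((\<lambda>s. ?c * \<rho> powr (- s)) \<longlongrightarrow> ?c) (at_right 0)" using that by simp
  qed
  show "((\<lambda>s. ennreal (?c * (R + 1) powr (- s))) \<longlongrightarrow> ennreal ?c) (at_right 0)"
    and "((\<lambda>s. ennreal (?c * (R - 1) powr (- s))) \<longlongrightarrow> ennreal ?c) (at_right 0)"
    by (rule lim; use assms in simp)+
qed (use assms in \<open>auto intro!: eventually_at_right_less[THEN eventually_mono]
      interaction_ball_complement_bounds\<close>)

text \<open>The annulus is at distance at least 1 from the unit ball, so the kernel is at most 1 and
  the interaction has a finite bound independent of \<open>s\<close>; the factor \<open>s\<close>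
  sends it to 0.\<close>

lemma tendsto_interaction_annulus:
  "((\<lambda>s. ennreal s * interaction s (ball (0::'a::euclidean_space) 1) (ball 0 r - ball 0 2)) \<longlongrightarrow> 0) (at_right 0)"
proof -
  define M where "M = emeasure lborel (ball (0::'a) r) * emeasure lborel (ball (0::'a) 1)"
  \<comment> \<open>Finiteness rules out the product of 0 and infinity, where multiplication on
    \<open>ennreal\<close> is not continuous.\<close>
  have "M < top" unfolding M_def
    by (intro ennreal_mult_less_top[THEN iffD2]) (auto simp: emeasure_lborel_ball_finite[unfolded infinity_ennreal_def])
  have bound: "interaction s (ball (0::'a) 1) (ball 0 r - ball 0 2) \<le> M" if s: "s > 0" for s
  proof -
    let ?k = "\<lambda>x y::'a. 1 / ennreal (norm (x - y) powr (real DIM('a) + s))"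
    have k: "?k x y \<le> 1" if "norm x < 1" "norm y \<ge> 2" for x y
    proof -
      have d: "norm (x - y) \<ge> 1"
        using that norm_triangle_ineq2[of y x] by (simp add: norm_minus_commute)
      then have "norm (x - y) powr (- (real DIM('a) + s)) \<le> norm (x - y) powr 0"
        using s by (intro powr_mono) auto
      also have "\<dots> = 1" using d by auto
      finally show ?thesis
        using d by (subst one_divide_ennreal_powr) auto
    qed
    have "interaction s (ball (0::'a) 1) (ball 0 r - ball 0 2)
        \<le> (\<integral>\<^sup>+x\<in>ball (0::'a) 1. (\<integral>\<^sup>+y. indicator (ball (0::'a) r) y \<partial>lebesgue) \<partial>lebesgue)"
      unfolding interaction_def
    proof (intro nn_integral_mono)
      fix x :: 'a
      have "(\<integral>\<^sup>+y\<in>ball 0 r - ball 0 2. ?k x y \<partial>lebesgue) \<le> (\<integral>\<^sup>+y. indicator (ball (0::'a) r) y \<partial>lebesgue)" if "norm x < 1"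
        by (intro nn_integral_mono) (use k that in \<open>auto split: split_indicator\<close>)
      then show "(\<integral>\<^sup>+y\<in>ball 0 r - ball 0 2. ?k x y \<partial>lebesgue) * indicator (ball 0 1) x
          \<le> (\<integral>\<^sup>+y. indicator (ball (0::'a) r) y \<partial>lebesgue) * indicator (ball 0 1) x"
        by (auto split: split_indicator)
    qed
    also have "\<dots> = M"
      by (simp add: M_def nn_integral_completion nn_integral_cmult_indicator)
    finally show ?thesis .
  qed
  have "((\<lambda>s. ennreal s * M) \<longlongrightarrow> ennreal 0 * M) (at_right 0)"
    using \<open>M < top\<close> by (intro tendsto_mult_ennreal tendsto_const tendsto_ennrealI) auto
  then have lim: "((\<lambda>s. ennreal s * M) \<longlongrightarrow> 0) (at_right 0)" by simp
  have le: "\<forall>\<^sub>F s in at_right 0. ennreal s * interaction s (ball (0::'a) 1) (ball 0 r - ball 0 2) \<le> ennreal s * M"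
    using eventually_at_right_less by (rule eventually_mono) (auto intro: mult_left_mono bound)
  show ?thesis
    by (rule tendsto_sandwich[OF _ le tendsto_const lim]) simp
qed

section \<open>Values of mu on the three sets\<close>

lemma mu_family_and_mu_eqI:
  assumes "E \<in> sets lebesgue" "m \<ge> 0"
    and "((\<lambda>s. ennreal s * s_perimeter s E \<Omega>) \<longlongrightarrow> ennreal m) (at_right 0)"
  shows "E \<in> mu_family \<Omega>" "mu \<Omega> E = m"
  using assms tendsto_Lim[OF _ assms(3)] by (auto simp: mu_family_def mu_def)

lemma interaction_empty [simp]: "interaction s {} B = 0" "interaction s A {} = 0"
  by (simp_all add: interaction_def)

theorem proposition2p3:
  shows "(\<exists>(\<Omega> :: (real ^ 'n::finite) set) \<gamma> E F c.
            open \<Omega> \<and> bounded \<Omega> \<and> 0 < \<gamma> \<and> \<gamma> < 1 \<and> C1_holder_boundary \<gamma> \<Omega> \<and>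
            E \<in> mu_family \<Omega> \<and> F \<in> mu_family \<Omega> \<and> E \<union> F \<in> mu_family \<Omega> \<and>
            0 < c \<and> c \<le> setdist E F \<and>
            mu \<Omega> (E \<union> F) < mu \<Omega> E + mu \<Omega> F)
       \<and> (\<exists>(\<Omega> :: (real ^ 'n::finite) set) \<gamma> E F.
            open \<Omega> \<and> bounded \<Omega> \<and> 0 < \<gamma> \<and> \<gamma> < 1 \<and> C1_holder_boundary \<gamma> \<Omega> \<and>
            E \<in> mu_family \<Omega> \<and> F \<in> mu_family \<Omega> \<and>
            E \<subseteq> F \<and> mu \<Omega> F < mu \<Omega> E)"
proof -
  \<comment> \<open>The gaps between the radii 1, 2, 3 keep \<Omega> at distance 1 from the annulus
    left between \<open>E\<close> and \<open>F\<close>, and \<open>E\<close> at distance 1 from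
    \<open>F\<close>.\<close>
  define \<Omega> E F :: "(real^'n) set" where "\<Omega> = ball 0 1" and "E = ball 0 2" and "F = - ball 0 3"
  \<comment> \<open>The area of the unit sphere times the volume of the unit ball.\<close>
  define c where "c = real DIM(real^'n) * (unit_ball_vol DIM(real^'n))\<^sup>2"
  have c: "c > 0" unfolding c_def by (intro mult_pos_pos zero_less_power unit_ball_vol_pos) auto
  have meas: "E \<in> sets lebesgue" "F \<in> sets lebesgue" "E \<union> F \<in> sets lebesgue"
    by (auto simp: E_def F_def)
  have \<Omega>: "open \<Omega>" "bounded \<Omega>" by (auto simp: \<Omega>_def)
  \<comment> \<open>\<Omega> lies inside \<open>E\<close>, so of the three terms only the second
    survives.\<close>
  have "s_perimeter s E \<Omega> = interaction s (ball 0 1 :: (real^'n) set) (- ball 0 2)" for s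
  proof -
    have "E \<inter> \<Omega> = ball 0 1" "- E \<inter> \<Omega> = {}" "- E \<inter> - \<Omega> = - ball 0 2"
      by (auto simp: E_def \<Omega>_def)
    then show ?thesis by (simp add: s_perimeter_def)
  qed
  then have "((\<lambda>s. ennreal s * s_perimeter s E \<Omega>) \<longlongrightarrow> ennreal c) (at_right 0)"
    using tendsto_interaction_ball_complement[of 2, where 'a="real^'n"] by (simp add: c_def)
  then have muE: "E \<in> mu_family \<Omega>" "mu \<Omega> E = c"
    by (rule mu_family_and_mu_eqI[OF meas(1) less_imp_le[OF c]])+
  \<comment> \<open>\<Omega> is disjoint from \<open>F\<close>, so only the third term survives,
    with the arguments in the opposite order.\<close>
  have "s_perimeter s F \<Omega> = interaction s (ball 0 1 :: (real^'n) set) (- ball 0 3)" for s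
  proof -
    have "F \<inter> \<Omega> = {}" "F \<inter> - \<Omega> = - ball 0 3" "- F \<inter> \<Omega> = ball 0 1"
      by (auto simp: F_def \<Omega>_def)
    then show ?thesis by (simp add: s_perimeter_def interaction_commute[of "- ball 0 3"])
  qed
  then have "((\<lambda>s. ennreal s * s_perimeter s F \<Omega>) \<longlongrightarrow> ennreal c) (at_right 0)"
    using tendsto_interaction_ball_complement[of 3, where 'a="real^'n"] by (simp add: c_def)
  then have muF: "F \<in> mu_family \<Omega>" "mu \<Omega> F = c"
    by (rule mu_family_and_mu_eqI[OF meas(2) less_imp_le[OF c]])+
  have "s_perimeter s (E \<union> F) \<Omega> = interaction s (ball 0 1 :: (real^'n) set) (ball 0 3 - ball 0 2)" for s
  proof -
    have "(E \<union> F) \<inter> \<Omega> = ball 0 1" "- (E \<union> F) \<inter> \<Omega> = {}" "- (E \<union> F) \<inter> - \<Omega> = ball 0 3 - ball 0 2"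
      by (auto simp: E_def F_def \<Omega>_def)
    then show ?thesis by (simp add: s_perimeter_def)
  qed
  then have "((\<lambda>s. ennreal s * s_perimeter s (E \<union> F) \<Omega>) \<longlongrightarrow> ennreal 0) (at_right 0)"
    using tendsto_interaction_annulus[of 3, where 'a="real^'n"] by simp
  then have muEF: "E \<union> F \<in> mu_family \<Omega>" "mu \<Omega> (E \<union> F) = 0"
    by (rule mu_family_and_mu_eqI[OF meas(3) order_refl])+
  \<comment> \<open>\<open>setdist\<close> is 0 by convention when a set is empty, hence the two
    nonemptiness goals.\<close>
  have dist: "1 \<le> setdist E F"
  proof (rule le_setdistI)
    show "E \<noteq> {}" by (auto simp: E_def)
    obtain x :: "real^'n" where "norm x = 3" using vector_choose_size[of 3] by auto
    then have "x \<in> F" by (simp add: F_def)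
    then show "F \<noteq> {}" by auto
    show "1 \<le> dist x y" if "x \<in> E" "y \<in> F" for x y
      using that norm_triangle_ineq2[of y x] by (auto simp: E_def F_def dist_norm norm_minus_commute)
  qed
  have hol: "C1_holder_boundary (1/2) \<Omega>"
    unfolding \<Omega>_def by (rule C1_holder_boundary_unit_ball)
  show ?thesis
  proof
    show "\<exists>(\<Omega> :: (real ^ 'n) set) \<gamma> E F c. open \<Omega> \<and> bounded \<Omega> \<and> 0 < \<gamma> \<and> \<gamma> < 1 \<and> C1_holder_boundary \<gamma> \<Omega> \<and>
        E \<in> mu_family \<Omega> \<and> F \<in> mu_family \<Omega> \<and> E \<union> F \<in> mu_family \<Omega> \<and> 0 < c \<and> c \<le> setdist E F \<and>
        mu \<Omega> (E \<union> F) < mu \<Omega> E + mu \<Omega> F"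
      \<comment> \<open>The witness 1 is the separation; the strict inequality becomes 0 < c +
        c.\<close>
      using \<Omega> hol muE muF muEF dist c
      by (intro exI[of _ \<Omega>] exI[of _ "1/2"] exI[of _ E] exI[of _ F] exI[of _ 1]) auto
    show "\<exists>(\<Omega> :: (real ^ 'n) set) \<gamma> E F. open \<Omega> \<and> bounded \<Omega> \<and> 0 < \<gamma> \<and> \<gamma> < 1 \<and> C1_holder_boundary \<gamma> \<Omega> \<and>
        E \<in> mu_family \<Omega> \<and> F \<in> mu_family \<Omega> \<and> E \<subseteq> F \<and> mu \<Omega> F < mu \<Omega> E"
      using \<Omega> hol muE muEF c
      by (intro exI[of _ \<Omega>] exI[of _ "1/2"] exI[of _ E] exI[of _ "E \<union> F"]) auto
  qed
qed

end
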